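(* The orbits of rowmotion on the zipper $Z_n$ can be partitioned into four sets $\mathcal{S}$, $\mathcal{M}$, $\mathcal{L}$ and $\mathcal{G}$ with the following properties. - $\mathcal{S}$ contains $2^{2n-1}$ orbits, and each $\mathcal{O}\in\mathcal{S}$ satisfies $\#\mathcal{O}=2$, $\chi(\mathcal{O})=2n+2$, $\hat\chi(\mathcal{O})=6n+4$. - $\mathcal{M}$ contains $2^{n+1}-2$ orbits, and each $\mathcal{O}\in\mathcal{M}$ satisfies $\#\mathcal{O}=2^{n+1}-1$, $\chi(\mathcal{O})=2^n(2n+1)$, $\hat\chi(\mathcal{O})=3\cdot2^n(2n-1)+5$. - $\mathcal{L}$ contains $1$ orbit, and it satisfies $\#\mathcal{O}=2^{n+1}$, $\chi(\mathcal{O})=2^n(2n+1)+1$, $\hat\chi(\mathcal{O})=3\cdot2^n(2n-1)+5$. - $\mathcal{G}$ contains $2^n$ orbits, and each $\mathcal{O}\in\mathcal{G}$ satisfies $\#\mathcal{O}=2^{n+2}-2$, $\chi(\mathcal{O})=2^n(4n+3)-n-1$, $\hat\chi(\mathcal{O})=2^{n-1}(51n-25)+3$. Thus $\chi$ and $\hat\chi$ are homometric on $Z_n$.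
   Context: For a finite poset $P$, let $\mathcal{A}(P)$ be its set of antichains, and for $Q\subseteq P$ let $Q{\downarrow}=\{x\in P: x\le y\text{ for some }y\in Q\}$. Rowmotion on antichains is the bijection $\rho(A)=\min\{x\in P: x\notin A{\downarrow}\}$ of $\mathcal{A}(P)$; rowmotion on lower order ideals is $\hat\rho(L)=\rho(\max L){\downarrow}$. The map $A\mapsto A{\downarrow}$ carries antichain orbits to ideal orbits. Orbits $\mathcal{O}$ are antichain orbits; $\chi(\mathcal{O})=\sum_{A\in\mathcal{O}}\#A$ and $\hat\chi(\mathcal{O})=\sum_{A\in\mathcal{O}}\#(A{\downarrow})$. A statistic $\mathrm{st}$ is homometric if $\mathrm{st}(\mathcal{O}_1)=\mathrm{st}(\mathcal{O}_2)$ for any two orbits with $\#\mathcal{O}_1=\#\mathcal{O}_2$. The comb $C_n$ ($n\ge1$) is the rooted tree (poset with unique minimal element whose Hasse diagram is a tree) on $2n+1$ elements: $n+1$ leaves (maximal elements) labeled $1,\dots,n+1$, and $n$ non-leaf elements $b_2,\dots,b_{n+1}$ with $b_{n+1}<b_n<\dots<b_2$, where $b_{n+1}$ is the root; for $3\le m\le n+1$ the element $b_m$ is covered by exactly $b_{m-1}$ and the leaf $m$; and $b_2$ is covered by exactly the leaves $1$ and $2$. The zipper $Z_n=C_n\oplus C_n$ is the rooted tree obtained from the disjoint union of two copies of $C_n$ by adjoining a new minimum element $\hat0$ (covered by exactly the roots of the two copies).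
   Formalization: The printed value of χ̂(O) for O in 𝒢, 2^{n-1}(51n−25)+3, is false for every n≥1 (for n=1 it gives 29, but the true sum is 26); it is replaced by the correct value 2^n(12n+1)−3n+3. Everything else is as stated. *)

theory Defs
  imports "HOL-Combinatorics.Orbits"
begin

text \<open>A poset is a relation \<open>r\<close> with \<open>Partial_order r\<close>; its underlying set is \<open>Field r\<close>.\<close>

definition antichains :: "'a rel \<Rightarrow> 'a set set" where
  "antichains r = {A. A \<subseteq> Field r \<and> (\<forall>x\<in>A. \<forall>y\<in>A. (x, y) \<in> r \<longrightarrow> x = y)}"

definition down_closure :: "'a rel \<Rightarrow> 'a set \<Rightarrow> 'a set" where
  "down_closure r Q = {x \<in> Field r. \<exists>y\<in>Q. (x, y) \<in> r}"

definition minimals :: "'a rel \<Rightarrow> 'a set \<Rightarrow> 'a set" where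
  "minimals r Q = {x \<in> Q. \<forall>y\<in>Q. (y, x) \<in> r \<longrightarrow> y = x}"

definition rowmotion :: "'a rel \<Rightarrow> 'a set \<Rightarrow> 'a set" where
  "rowmotion r A = minimals r {x \<in> Field r. x \<notin> down_closure r A}"

text \<open>
  The library's \<open>orbit f A\<close> consists of the iterates \<open>(f ^^ k) A\<close> with \<open>k > 0\<close>.  On a finite
  poset rowmotion permutes the antichains, so this is the full orbit and contains \<open>A\<close>.
\<close>
definition row_orbits :: "'a rel \<Rightarrow> 'a set set set" where
  "row_orbits r = orbit (rowmotion r) ` antichains r"

definition chi :: "'a set set \<Rightarrow> nat" where
  "chi Orb = (\<Sum>A\<in>Orb. card A)"

definition chi_hat :: "'a rel \<Rightarrow> 'a set set \<Rightarrow> nat" where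
  "chi_hat r Orb = (\<Sum>A\<in>Orb. card (down_closure r A))"

definition homometric :: "'a rel \<Rightarrow> ('a set set \<Rightarrow> 'b) \<Rightarrow> bool" where
  "homometric r st \<longleftrightarrow>
     (\<forall>Orb1\<in>row_orbits r. \<forall>Orb2\<in>row_orbits r. card Orb1 = card Orb2 \<longrightarrow> st Orb1 = st Orb2)"

text \<open>The element \<open>b\<^sub>m\<close> of the comb is \<open>Spine m\<close>.\<close>
datatype comb_vertex = Leaf nat | Spine nat

definition comb_verts :: "nat \<Rightarrow> comb_vertex set" where
  "comb_verts n = Leaf ` {1..n + 1} \<union> Spine ` {2..n + 1}"

text \<open>A pair \<open>(x, y)\<close> means that \<open>x\<close> is covered by \<open>y\<close>.\<close>
definition comb_covers :: "nat \<Rightarrow> comb_vertex rel" where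
  "comb_covers n =
     {(Spine m, Spine (m - 1)) | m. 3 \<le> m \<and> m \<le> n + 1} \<union>
     {(Spine m, Leaf m) | m. 3 \<le> m \<and> m \<le> n + 1} \<union>
     {(Spine 2, Leaf 1), (Spine 2, Leaf 2)}"

text \<open>\<open>rtrancl\<close> is reflexive on the whole type, hence the restriction.\<close>
definition comb :: "nat \<Rightarrow> comb_vertex rel" where
  "comb n = Restr ((comb_covers n)\<^sup>*) (comb_verts n)"

text \<open>The disjoint union of two posets with a new minimum \<open>None\<close> adjoined.\<close>
definition root_sum :: "'a rel \<Rightarrow> 'b rel \<Rightarrow> ('a + 'b) option rel" where
  "root_sum r s =
     {(None, x) | x. x \<in> insert None (Some ` (Field r <+> Field s))} \<union>
     {(Some (Inl x), Some (Inl y)) | x y. (x, y) \<in> r} \<union>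
     {(Some (Inr x), Some (Inr y)) | x y. (x, y) \<in> s}"

definition zipper :: "nat \<Rightarrow> (comb_vertex + comb_vertex) option rel" where
  "zipper n = root_sum (comb n) (comb n)"

text \<open>
  The literature gives \<open>\<chi>\<close>-hat on the largest orbits of the zipper as \<open>2^(n-1) * (51*n - 25) + 3\<close>.
  This is a misprint: for \<open>n \<ge> 2\<close> it exceeds \<open>(2^(n+2) - 2) * (4*n + 3)\<close>, the size of the orbit
  times the size of the poset, and for \<open>n = 1\<close> it gives 29 while the actual sum is 26.  The value
  used is \<open>2^n * (12*n + 1) - 3*n + 3\<close>, found by computing all orbits for \<open>1 \<le> n \<le> 6\<close>.
\<close>

lemma Field_comb: "Field (comb n) = comb_verts n"
  by (auto simp: comb_def Field_def)

lemma Partial_order_comb: "Partial_order (comb n)"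
proof -
  define \<mu> where "\<mu> x = (case x of Leaf _ \<Rightarrow> 0 | Spine m \<Rightarrow> m)" for x
  have dec: "\<mu> y < \<mu> x" if "(x, y) \<in> comb_covers n" for x y
    using that by (auto simp: comb_covers_def \<mu>_def)
  have dec': "x = y \<or> \<mu> y < \<mu> x" if "(x, y) \<in> (comb_covers n)\<^sup>*" for x y
    using that by (induction rule: rtrancl_induct) (use dec in force)+
  have "antisym (comb n)"
  proof (rule antisymI)
    fix x y assume "(x, y) \<in> comb n" "(y, x) \<in> comb n"
    then show "x = y"
      using dec'[of x y] dec'[of y x] by (auto simp: comb_def)
  qed
  moreover have "trans (comb n)"
    by (rule transI) (auto simp: comb_def)
  moreover have "refl_on (comb_verts n) (comb n)"
    by (auto simp: comb_def refl_on_def)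
  moreover have "comb n \<subseteq> comb_verts n \<times> comb_verts n"
    by (auto simp: comb_def)
  ultimately show ?thesis
    by (simp add: Field_comb partial_order_on_def preorder_on_def)
qed

lemma Field_root_sum: "Field (root_sum r s) = insert None (Some ` (Field r <+> Field s))"
  by (fastforce simp: root_sum_def Field_def)

lemma Partial_order_root_sum:
  assumes "Partial_order r" "Partial_order s"
  shows "Partial_order (root_sum r s)"
proof -
  have r: "refl_on (Field r) r" "trans r" "antisym r" and s: "refl_on (Field s) s" "trans s" "antisym s"
    using assms by (auto simp: partial_order_on_def preorder_on_def)
  have "antisym (root_sum r s)"
    by (rule antisymI) (use r s in \<open>auto simp: root_sum_def dest: antisymD\<close>)
  moreover have "trans (root_sum r s)"
    by (rule transI) (use r s in \<open>auto simp: root_sum_def Field_def dest: transD\<close>)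
  moreover have "refl_on (Field (root_sum r s)) (root_sum r s)"
    unfolding Field_root_sum using r s by (auto simp: refl_on_def root_sum_def)
  moreover have "root_sum r s \<subseteq> Field (root_sum r s) \<times> Field (root_sum r s)"
    by (auto simp: Field_def)
  ultimately show ?thesis
    by (simp add: partial_order_on_def preorder_on_def)
qed

lemma Partial_order_zipper: "Partial_order (zipper n)"
  unfolding zipper_def by (intro Partial_order_root_sum Partial_order_comb)

lemma card_comb_verts: "card (comb_verts n) = 2 * n + 1"
  unfolding comb_verts_def by (subst card_Un_disjoint) (auto simp: card_image inj_on_def)

end

theory Submission
  imports Defs
begin

text \<open>
  Adjoining a new root below a disjoint union of two posets changes rowmotion very little.  An
  antichain of \<^term>\<open>root_sum r s\<close> is either the root alone or a pair \<open>(A, B)\<close> of antichains of \<open>r\<close>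
  and \<open>s\<close>, and rowmotion acts on each entry of the pair separately, with one exception: the
  root is inserted between \<open>({}, {})\<close> and its image under the product map.  So the orbits of
  \<^term>\<open>root_sum r s\<close> are the orbits of a product of two permutations, and one of them, the orbit of
  \<open>({}, {})\<close>, is longer by one (\<open>orbit_root_sum_empty\<close>).  The orbit of a pair whose entries have
  orbits of sizes \<open>p\<close> and \<open>q\<close> has size \<open>lcm p q\<close> and passes \<open>lcm p q div p\<close> times through the first
  orbit and \<open>lcm p q div q\<close> times through the second, which yields both statistics
  (\<open>orbit_data_fork\<close>).

  The comb \<^term>\<open>comb (Suc n)\<close> arises from \<^term>\<open>comb n\<close> by joining it to a single point at a
  new root.  A point has one orbit, of size 2.  It follows by induction that a comb with a
  nonempty spine has exactly two kinds of orbits: a long one, that of the empty antichain, of odd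
  size \<open>p\<close>, and orbits of size 2.  The long orbit and the new point have coprime sizes, so together
  they form one orbit of size \<open>2 * p\<close>, and the root makes it \<open>2 * p + 1\<close>, again odd; an orbit of
  size 2 and the point form orbits of size 2.  The resulting recursions for the statistics are
  solved in \<open>orbit_dichotomy_comb\<close>.

  The zipper joins two equal combs, so its orbits come from three kinds of pairs: short with short
  (size 2, the set \<open>S\<close>), long with short (size \<open>2 * p\<close>, the set \<open>G\<close>), and long with long (size \<open>p\<close>,
  the set \<open>M\<close>, except for the orbit through \<open>({}, {})\<close>, which has size \<open>p + 1\<close> and forms \<open>L\<close>).  The
  number of orbits of each kind is the number of antichains of that kind divided by the size.  The
  four sizes are different, which makes both statistics homometric.
\<close>

section \<open>Orbits of a product of two maps\<close>

lemma orbit_eq_of_mem: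
  assumes "x \<in> orbit f x" "y \<in> orbit f x"
  shows "orbit f y = orbit f x"
  using cyclic_on_singleI[OF assms(1) refl] assms(2) by (rule orbit_cyclic_eq3)

lemma funpow_fixes_iff:
  assumes "x \<in> orbit f x"
  shows "(f ^^ k) x = x \<longleftrightarrow> card (orbit f x) dvd k"
proof -
  define p where "p = funpow_dist1 f x x"
  have "p > 0"
    by (simp add: p_def)
  have p: "(f ^^ p) x = x"
    unfolding p_def using assms by (rule funpow_dist1_prop)
  have "card (orbit f x) = p"
    using assms by (subst orbit_conv_funpow_dist1) (simp_all add: card_image inj_on_funpow_dist1 p_def)
  moreover have "(f ^^ (k mod p)) x = x \<longleftrightarrow> k mod p = 0"
    using funpow_dist1_least[of "k mod p" f x x] \<open>p > 0\<close> by (auto simp: p_def)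
  ultimately show ?thesis
    by (simp add: funpow_mod_eq[OF p] dvd_eq_mod_eq_0)
qed

text \<open>
  The size of an orbit is thus determined by the set of exponents at which the iterates return,
  which for a product of two maps is easier to find than the orbit itself.
\<close>
lemma card_orbitI:
  assumes "p > 0" and fixes_iff: "\<And>k. (f ^^ k) x = x \<longleftrightarrow> p dvd k"
  shows "x \<in> orbit f x" "card (orbit f x) = p"
proof -
  have "(f ^^ p) x = x"
    by (simp add: fixes_iff)
  with \<open>p > 0\<close> show x: "x \<in> orbit f x"
    by (force simp: orbit_altdef)
  show "card (orbit f x) = p"
    using funpow_fixes_iff[OF x] fixes_iff by (metis dvd_antisym dvd_refl)
qed

lemma orbit_eq_image_funpow:
  assumes "x \<in> orbit f x"
  shows "orbit f x = (\<lambda>k. (f ^^ k) x) ` {..<card (orbit f x)}"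
    and "inj_on (\<lambda>k. (f ^^ k) x) {..<card (orbit f x)}"
proof -
  have "card (orbit f x) = funpow_dist1 f x x"
    using assms by (subst orbit_conv_funpow_dist1) (simp_all add: card_image inj_on_funpow_dist1)
  then show "orbit f x = (\<lambda>k. (f ^^ k) x) ` {..<card (orbit f x)}"
    and "inj_on (\<lambda>k. (f ^^ k) x) {..<card (orbit f x)}"
    using orbit_conv_funpow_dist1[OF assms] inj_on_funpow_dist1[OF assms]
    by (simp_all add: lessThan_atLeast0)
qed

text \<open>
  A walk whose length is a multiple of the size of the orbit goes around the orbit a whole number
  of times.
\<close>
lemma sum_funpow_laps:
  fixes u :: "'a \<Rightarrow> nat"
  assumes "x \<in> orbit f x" "card (orbit f x) dvd m"
  shows "(\<Sum>k<m. u ((f ^^ k) x)) = m div card (orbit f x) * (\<Sum>y\<in>orbit f x. u y)"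
proof -
  define p where "p = card (orbit f x)"
  obtain l where m: "m = l * p"
    using assms(2) by (metis dvdE mult.commute p_def)
  have p: "p > 0"
    using finite_orbit[OF assms(1)] by (simp add: p_def card_gt_0_iff orbit_nonempty)
  have lap: "(\<Sum>k=i * p..<i * p + p. u ((f ^^ k) x)) = (\<Sum>y\<in>orbit f x. u y)" for i
  proof -
    have "(f ^^ (k + i * p)) x = (f ^^ k) x" for k
      using funpow_fixes_iff[OF assms(1), of "i * p"] by (simp add: funpow_add p_def)
    then have "(\<Sum>k=i * p..<i * p + p. u ((f ^^ k) x)) = (\<Sum>k<p. u ((f ^^ k) x))"
      using sum.shift_bounds_nat_ivl[of "\<lambda>k. u ((f ^^ k) x)" 0 "i * p" p]
      by (simp add: add.commute lessThan_atLeast0)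
    also have "\<dots> = (\<Sum>y\<in>orbit f x. u y)"
      using orbit_eq_image_funpow[OF assms(1)] sum.reindex[of "\<lambda>k. (f ^^ k) x" "{..<p}" u]
      by (simp add: p_def)
    finally show ?thesis .
  qed
  show ?thesis
    using p sum.nat_group[of "\<lambda>k. u ((f ^^ k) x)" p l] by (simp add: m lap flip: p_def)
qed

text \<open>The orbits partition \<open>X\<close> into blocks of the same size.\<close>
lemma card_mult_orbits:
  assumes "finite X" and recur: "\<And>x. x \<in> X \<Longrightarrow> x \<in> orbit f x"
    and closed: "\<And>x. x \<in> X \<Longrightarrow> orbit f x \<subseteq> X"
    and size: "\<And>x. x \<in> X \<Longrightarrow> card (orbit f x) = k"
  shows "k * card (orbit f ` X) = card X"
proof -
  have union: "\<Union> (orbit f ` X) = X"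
    using recur closed by blast
  have "k * card (orbit f ` X) = card (\<Union> (orbit f ` X))"
  proof (rule card_partition)
    show "finite (\<Union> (orbit f ` X))"
      unfolding union by fact
    fix c1 c2
    assume "c1 \<in> orbit f ` X" "c2 \<in> orbit f ` X" "c1 \<noteq> c2"
    moreover have "c = orbit f z" if "c \<in> orbit f ` X" "z \<in> c" for c z
      using that recur orbit_eq_of_mem by fast
    ultimately show "c1 \<inter> c2 = {}"
      by blast
  qed (use \<open>finite X\<close> size in auto)
  then show ?thesis
    unfolding union .
qed

lemma funpow_map_prod:
  fixes f :: "'a \<Rightarrow> 'a" and g :: "'b \<Rightarrow> 'b"
  shows "(map_prod f g ^^ k) (x, y) = ((f ^^ k) x, (g ^^ k) y)"
  by (induction k) auto

text \<open>A pair returns exactly when both of its entries do, that is at the common multiples of the two sizes.\<close>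
lemma orbit_map_prod:
  assumes x: "x \<in> orbit f x" and y: "y \<in> orbit g y"
  shows "(x, y) \<in> orbit (map_prod f g) (x, y)"
    and "card (orbit (map_prod f g) (x, y)) = lcm (card (orbit f x)) (card (orbit g y))"
proof -
  let ?m = "lcm (card (orbit f x)) (card (orbit g y))"
  have m: "?m > 0"
    using finite_orbit[OF x] finite_orbit[OF y] by (intro lcm_pos_nat) (simp_all add: card_gt_0_iff orbit_nonempty)
  have "(map_prod f g ^^ k) (x, y) = (x, y) \<longleftrightarrow> ?m dvd k" for k
    using assms by (simp add: funpow_map_prod funpow_fixes_iff lcm_least_iff)
  from card_orbitI[OF m this]
  show "(x, y) \<in> orbit (map_prod f g) (x, y)" "card (orbit (map_prod f g) (x, y)) = ?m" .
qed

text \<open>One turn of the pair is a whole number of laps for each entry.\<close>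
lemma sum_orbit_map_prod:
  fixes u :: "'a \<Rightarrow> nat" and v :: "'b \<Rightarrow> nat"
  assumes x: "x \<in> orbit f x" and y: "y \<in> orbit g y"
  defines "m \<equiv> lcm (card (orbit f x)) (card (orbit g y))"
  shows "(\<Sum>(a, b)\<in>orbit (map_prod f g) (x, y). u a + v b) =
    m div card (orbit f x) * (\<Sum>a\<in>orbit f x. u a) + m div card (orbit g y) * (\<Sum>b\<in>orbit g y. v b)"
proof -
  let ?h = "map_prod f g"
  note xy = orbit_map_prod[OF x y]
  have "(\<Sum>(a, b)\<in>orbit ?h (x, y). u a + v b) = (\<Sum>k<m. case (?h ^^ k) (x, y) of (a, b) \<Rightarrow> u a + v b)"
    using orbit_eq_image_funpow(2)[OF xy(1)]
    by (subst orbit_eq_image_funpow(1)[OF xy(1)]) (simp add: m_def xy(2) sum.reindex)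
  also have "\<dots> = (\<Sum>k<m. u ((f ^^ k) x)) + (\<Sum>k<m. v ((g ^^ k) y))"
    by (simp add: funpow_map_prod sum.distrib)
  finally show ?thesis
    using x y by (simp add: sum_funpow_laps m_def)
qed

text \<open>The orbit of the pair lies in the product of the two orbits and already has as many elements.\<close>
lemma orbit_map_prod_coprime:
  assumes x: "x \<in> orbit f x" and y: "y \<in> orbit g y"
    and "coprime (card (orbit f x)) (card (orbit g y))"
  shows "orbit (map_prod f g) (x, y) = orbit f x \<times> orbit g y"
proof (rule card_subset_eq)
  show "finite (orbit f x \<times> orbit g y)"
    using x y by (simp add: finite_orbit)
  have "z \<in> orbit f x \<times> orbit g y" if "z \<in> orbit (map_prod f g) (x, y)" for z
    using that by induction (auto intro: orbit.intros)
  then show "orbit (map_prod f g) (x, y) \<subseteq> orbit f x \<times> orbit g y"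
    by blast
  show "card (orbit (map_prod f g) (x, y)) = card (orbit f x \<times> orbit g y)"
    using assms by (simp add: orbit_map_prod card_cartesian_product lcm_coprime)
qed

section \<open>Rowmotion after joining two posets at a new root\<close>

text \<open>
  On a finite poset rowmotion is a bijection of the antichains, so that every finite poset is
  recurrent.  For combs and zippers it is simpler to carry the property along the construction.
\<close>
definition recurrent :: "'a rel \<Rightarrow> bool" where
  "recurrent r \<longleftrightarrow> (\<forall>A\<in>antichains r. A \<in> orbit (rowmotion r) A)"

definition orbit_data :: "'a rel \<Rightarrow> 'a set \<Rightarrow> nat \<times> nat \<times> nat" where
  "orbit_data r A = (let Orb = orbit (rowmotion r) A in (card Orb, chi Orb, chi_hat r Orb))"

lemma empty_in_antichains [simp]: "{} \<in> antichains r"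
  by (simp add: antichains_def)

lemma finite_antichains: "finite (Field r) \<Longrightarrow> finite (antichains r)"
  by (rule finite_subset[of _ "Pow (Field r)"]) (auto simp: antichains_def)

lemma rowmotion_in_antichains: "rowmotion r A \<in> antichains r"
  by (auto simp: antichains_def rowmotion_def minimals_def)

lemma orbit_rowmotion_subset: "orbit (rowmotion r) A \<subseteq> antichains r"
proof
  fix B
  assume "B \<in> orbit (rowmotion r) A"
  then show "B \<in> antichains r"
    by induction (simp_all add: rowmotion_in_antichains)
qed

text \<open>
  A pair of sets is placed above the root of \<^const>\<open>root_sum\<close>, the first entry on the left
  branch and the second on the right one.
\<close>
definition fork :: "'a set \<times> 'b set \<Rightarrow> ('a + 'b) option set" where
  "fork P = Some ` (fst P <+> snd P)"

lemma fork_iffs [simp]: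
  "None \<notin> fork P"
  "Some (Inl a) \<in> fork P \<longleftrightarrow> a \<in> fst P"
  "Some (Inr b) \<in> fork P \<longleftrightarrow> b \<in> snd P"
  by (auto simp: fork_def)

lemma bex_fork [simp]:
  "(\<exists>x\<in>fork P. Q x) \<longleftrightarrow> (\<exists>a\<in>fst P. Q (Some (Inl a))) \<or> (\<exists>b\<in>snd P. Q (Some (Inr b)))"
  by (auto simp: fork_def Plus_def)

lemma ball_fork [simp]:
  "(\<forall>x\<in>fork P. Q x) \<longleftrightarrow> (\<forall>a\<in>fst P. Q (Some (Inl a))) \<and> (\<forall>b\<in>snd P. Q (Some (Inr b)))"
  by (auto simp: fork_def Plus_def)

lemma set_eq_by_root:
  assumes "None \<in> X \<longleftrightarrow> None \<in> Y"
    and "\<And>a. Some (Inl a) \<in> X \<longleftrightarrow> Some (Inl a) \<in> Y"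
    and "\<And>b. Some (Inr b) \<in> X \<longleftrightarrow> Some (Inr b) \<in> Y"
  shows "X = Y"
proof (rule set_eqI)
  fix x
  show "x \<in> X \<longleftrightarrow> x \<in> Y"
    using assms by (metis option.exhaust sum.exhaust)
qed

lemma inj_fork: "inj fork"
proof (rule injI)
  fix P Q :: "'a set \<times> 'b set"
  assume eq: "fork P = fork Q"
  have "a \<in> fst P \<longleftrightarrow> a \<in> fst Q" "b \<in> snd P \<longleftrightarrow> b \<in> snd Q" for a b
    using fork_iffs(2)[of a P] fork_iffs(3)[of b P] by (simp_all add: eq)
  then show "P = Q"
    by (simp add: prod_eq_iff set_eq_iff)
qed

lemma fork_empty [simp]: "fork ({}, {}) = {}"
  by (simp add: fork_def)

lemma root_sum_simps [simp]:
  "(None, None) \<in> root_sum r s"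
  "(None, Some (Inl a)) \<in> root_sum r s \<longleftrightarrow> a \<in> Field r"
  "(None, Some (Inr b)) \<in> root_sum r s \<longleftrightarrow> b \<in> Field s"
  "(Some y, None) \<in> root_sum r s \<longleftrightarrow> False"
  "(Some (Inl a), Some (Inl a')) \<in> root_sum r s \<longleftrightarrow> (a, a') \<in> r"
  "(Some (Inr b), Some (Inr b')) \<in> root_sum r s \<longleftrightarrow> (b, b') \<in> s"
  "(Some (Inl a), Some (Inr b)) \<in> root_sum r s \<longleftrightarrow> False"
  "(Some (Inr b), Some (Inl a)) \<in> root_sum r s \<longleftrightarrow> False"
  by (auto simp: root_sum_def)

text \<open>The root is comparable to everything, so an antichain that contains it contains nothing else.\<close>
lemma antichains_root_sum:
  "antichains (root_sum r s) = insert {None} (fork ` (antichains r \<times> antichains s))"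
proof (intro Set.equalityI subsetI)
  fix C
  assume C: "C \<in> antichains (root_sum r s)"
  then have sub: "C \<subseteq> insert None (Some ` (Field r <+> Field s))"
    by (simp add: antichains_def Field_root_sum)
  show "C \<in> insert {None} (fork ` (antichains r \<times> antichains s))"
  proof (cases "None \<in> C")
    case True
    have "(None, y) \<in> root_sum r s" if "y \<in> C" for y
      using sub that by (auto simp: root_sum_def)
    with True C have "C = {None}"
      unfolding antichains_def by blast
    then show ?thesis
      by simp
  next
    case False
    define A B where "A = {a. Some (Inl a) \<in> C}" and "B = {b. Some (Inr b) \<in> C}"
    have "c \<in> C \<longleftrightarrow> c \<in> fork (A, B)" for c
    proof (cases c)
      case (Some d)
      then show ?thesis
        by (cases d) (simp_all add: A_def B_def)
    qed (simp add: False)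
    then have "C = fork (A, B)"
      by blast
    moreover have "A \<subseteq> Field r" "B \<subseteq> Field s"
      using sub by (auto simp: A_def B_def)
    then have "A \<in> antichains r" "B \<in> antichains s"
      using C by (fastforce simp: antichains_def A_def B_def)+
    ultimately show ?thesis
      by blast
  qed
next
  fix C
  assume "C \<in> insert {None} (fork ` (antichains r \<times> antichains s))"
  then consider "C = {None}"
    | A B where "C = fork (A, B)" "A \<in> antichains r" "B \<in> antichains s"
    by auto
  then show "C \<in> antichains (root_sum r s)"
    by cases (auto simp: antichains_def Field_root_sum fork_def)
qed

lemma down_closure_root: "down_closure (root_sum r s) {None} = {None}"
  by (auto simp: down_closure_def Field_root_sum)

lemma down_closure_fork:
  assumes "A \<subseteq> Field r" "B \<subseteq> Field s"
  shows "down_closure (root_sum r s) (fork (A, B)) =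
    (if A = {} \<and> B = {} then {} else {None}) \<union> fork (down_closure r A, down_closure s B)"
  using assms by (intro set_eq_by_root) (auto simp: down_closure_def Field_root_sum)

lemma minimals_fork:
  "minimals (root_sum r s) (fork (A, B)) = fork (minimals r A, minimals s B)"
  by (intro set_eq_by_root) (auto simp: minimals_def)

text \<open>
  The root generates only itself, so its image consists of the minimal elements of both branches,
  and these are also what rowmotion makes of the empty antichain on each branch.
\<close>
lemma rowmotion_root_sum_root:
  "rowmotion (root_sum r s) {None} = fork (rowmotion r {}, rowmotion s {})"
proof -
  have "{x \<in> Field (root_sum r s). x \<notin> down_closure (root_sum r s) {None}} = fork (Field r, Field s)"
    by (intro set_eq_by_root) (auto simp: down_closure_root Field_root_sum)
  then show ?thesis
    by (simp add: rowmotion_def minimals_fork down_closure_def)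
qed

lemma rowmotion_root_sum_empty: "rowmotion (root_sum r s) {} = {None}"
  by (auto simp: rowmotion_def minimals_def down_closure_def Field_root_sum)

text \<open>
  As soon as one entry is nonempty, the root lies in the generated ideal, and the two branches no
  longer influence each other.
\<close>
lemma rowmotion_root_sum_fork:
  assumes "A \<in> antichains r" "B \<in> antichains s" "(A, B) \<noteq> ({}, {})"
  shows "rowmotion (root_sum r s) (fork (A, B)) = fork (rowmotion r A, rowmotion s B)"
proof -
  have AB: "A \<subseteq> Field r" "B \<subseteq> Field s"
    using assms by (auto simp: antichains_def)
  have "{x \<in> Field (root_sum r s). x \<notin> down_closure (root_sum r s) (fork (A, B))} =
      fork ({x \<in> Field r. x \<notin> down_closure r A}, {x \<in> Field s. x \<notin> down_closure s B})"
    using assms(3) unfolding down_closure_fork[OF AB]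
    by (intro set_eq_by_root) (auto simp: Field_root_sum)
  then show ?thesis
    by (simp add: rowmotion_def minimals_fork)
qed

abbreviation row_pair :: "'a rel \<Rightarrow> 'b rel \<Rightarrow> 'a set \<times> 'b set \<Rightarrow> 'a set \<times> 'b set" where
  "row_pair r s \<equiv> map_prod (rowmotion r) (rowmotion s)"

lemma orbit_row_pair_subset: "orbit (row_pair r s) P \<subseteq> antichains r \<times> antichains s"
proof
  fix Q
  assume "Q \<in> orbit (row_pair r s) P"
  then show "Q \<in> antichains r \<times> antichains s"
    by induction (auto simp: map_prod_def rowmotion_in_antichains split: prod.splits)
qed

lemma orbit_fork_not_empty:
  assumes P: "P \<in> orbit (row_pair r s) P" and "({}, {}) \<notin> orbit (row_pair r s) P"
  shows "orbit (rowmotion (root_sum r s)) (fork P) = fork ` orbit (row_pair r s) P"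
proof (rule orbit_inverse[OF P, symmetric])
  fix Q
  assume Q: "Q \<in> orbit (row_pair r s) P"
  obtain A B where [simp]: "Q = (A, B)"
    by fastforce
  show "rowmotion (root_sum r s) (fork Q) = fork (row_pair r s Q)"
    using Q assms(2) orbit_row_pair_subset[of r s P]
    by (metis SigmaD1 SigmaD2 \<open>Q = (A, B)\<close> map_prod_simp rowmotion_root_sum_fork subsetD)
qed

text \<open>
  Where the product map would go from \<open>({}, {})\<close> straight to its image, rowmotion makes a stop at
  the root.
\<close>
lemma orbit_root:
  assumes e: "({}, {}) \<in> orbit (row_pair r s) ({}, {})"
  shows "orbit (rowmotion (root_sum r s)) {None} =
    insert {None} (fork ` orbit (row_pair r s) ({}, {}))" (is "?L = ?R")
proof -
  have next_root: "rowmotion (root_sum r s) {None} = fork (row_pair r s ({}, {}))"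
    by (simp add: rowmotion_root_sum_root)
  have next_fork: "rowmotion (root_sum r s) (fork Q) = (if Q = ({}, {}) then {None} else fork (row_pair r s Q))"
    if "Q \<in> orbit (row_pair r s) ({}, {})" for Q
  proof -
    obtain A B where "Q = (A, B)"
      by fastforce
    moreover from this have "A \<in> antichains r" "B \<in> antichains s"
      using that orbit_row_pair_subset[of r s "({}, {})"] by auto
    ultimately show ?thesis
      using rowmotion_root_sum_fork[of A r B s] by (simp add: rowmotion_root_sum_empty)
  qed
  have "C \<in> ?R" if "C \<in> ?L" for C
    using that
  proof induction
    case base
    show ?case
      unfolding next_root by (intro insertI2 imageI orbit.base)
  next
    case (step C)
    from step.IH consider "C = {None}" | Q where "C = fork Q" "Q \<in> orbit (row_pair r s) ({}, {})"
      by blast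
    then show ?case
    proof cases
      case 1
      show ?thesis
        unfolding 1 next_root by (intro insertI2 imageI orbit.base)
    next
      case 2
      then show ?thesis
        using orbit.step[OF 2(2)] by (cases "Q = ({}, {})") (simp_all only: next_fork refl if_True if_False insertI1 insertI2 imageI)
    qed
  qed
  moreover have fork_in: "fork Q \<in> ?L" if "Q \<in> orbit (row_pair r s) ({}, {})" for Q
    using that
  proof induction
    case base
    show ?case
      using orbit.base[of "rowmotion (root_sum r s)" "{None}"] unfolding next_root .
  next
    case (step Q)
    show ?case
    proof (cases "Q = ({}, {})")
      case True
      show ?thesis
        using orbit.base[of "rowmotion (root_sum r s)" "{None}"] unfolding next_root True .
    next
      case False
      then show ?thesis
        using orbit.step[OF step.IH] next_fork[OF step.hyps] by simp
    qed
  qed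
  moreover have "{None} \<in> ?L"
    using orbit.step[OF fork_in[OF e]] by (simp add: rowmotion_root_sum_empty)
  ultimately show ?thesis
    by blast
qed

lemma orbit_fork_empty:
  assumes P: "P \<in> orbit (row_pair r s) P" and e: "({}, {}) \<in> orbit (row_pair r s) P"
  shows "orbit (rowmotion (root_sum r s)) (fork P) = insert {None} (fork ` orbit (row_pair r s) P)"
proof -
  have eq: "orbit (row_pair r s) ({}, {}) = orbit (row_pair r s) P"
    using P e by (rule orbit_eq_of_mem)
  have root: "orbit (rowmotion (root_sum r s)) {None} = insert {None} (fork ` orbit (row_pair r s) P)"
    using orbit_root[of r s] e eq by simp
  then show ?thesis
    using P by (subst orbit_eq_of_mem[of "{None}"]) auto
qed

lemma pair_recurrent:
  assumes "recurrent r" "recurrent s" "A \<in> antichains r" "B \<in> antichains s"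
  shows "(A, B) \<in> orbit (row_pair r s) (A, B)"
  using assms by (simp add: recurrent_def orbit_map_prod)

lemma recurrent_root_sum:
  assumes "recurrent r" "recurrent s"
  shows "recurrent (root_sum r s)"
  unfolding recurrent_def antichains_root_sum
proof (intro ballI)
  fix C
  assume "C \<in> insert {None} (fork ` (antichains r \<times> antichains s))"
  then consider "C = {None}"
    | A B where "C = fork (A, B)" "A \<in> antichains r" "B \<in> antichains s"
    by auto
  then show "C \<in> orbit (rowmotion (root_sum r s)) C"
  proof cases
    case 1
    then show ?thesis
      using orbit_root[of r s] pair_recurrent[OF assms, of "{}" "{}"] by simp
  next
    case 2
    then show ?thesis
      using pair_recurrent[OF assms, of A B] orbit_fork_empty[of "(A, B)" r s]
        orbit_fork_not_empty[of "(A, B)" r s]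
      by (cases "({}, {}) \<in> orbit (row_pair r s) (A, B)") auto
  qed
qed

lemma card_fork: "finite A \<Longrightarrow> finite B \<Longrightarrow> card (fork (A, B)) = card A + card B"
  by (simp add: fork_def card_image card_Plus)

lemma finite_down_closure: "finite (Field r) \<Longrightarrow> finite (down_closure r A)"
  by (simp add: down_closure_def)

lemma down_closure_empty [simp]: "down_closure r {} = {}"
  by (simp add: down_closure_def)

lemma card_down_closure_fork:
  assumes "finite (Field r)" "finite (Field s)" "A \<in> antichains r" "B \<in> antichains s"
  shows "card (down_closure (root_sum r s) (fork (A, B))) =
    card (down_closure r A) + card (down_closure s B) + (if (A, B) = ({}, {}) then 0 else 1)"
proof -
  have "A \<subseteq> Field r" "B \<subseteq> Field s"
    using assms by (auto simp: antichains_def)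
  moreover have "finite (fork (down_closure r A, down_closure s B))"
    using assms by (simp add: fork_def finite_down_closure)
  ultimately show ?thesis
    using assms by (auto simp: down_closure_fork card_fork finite_down_closure)
qed

text \<open>
  The number \<open>e\<close> records whether the orbit passes through the antichain of the root alone, which
  lengthens the orbit by one step and by one element.  The root also adds \<open>m\<close> to the ideal sizes in both cases: it
  belongs to the ideal of every fork except the empty one, and in the orbit of the empty fork the
  antichain that consists of the root alone makes up for that one.
\<close>
lemma orbit_data_fork:
  assumes fin: "finite (Field r)" "finite (Field s)" and rec: "recurrent r" "recurrent s"
    and AB: "A \<in> antichains r" "B \<in> antichains s"
    and r: "orbit_data r A = (p, c, h)" and s: "orbit_data s B = (q, d, k)"
  defines "m \<equiv> lcm p q"
    and "e \<equiv> if ({}, {}) \<in> orbit (row_pair r s) (A, B) then 1 else 0"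
  shows "orbit_data (root_sum r s) (fork (A, B)) =
    (m + e, m div p * c + m div q * d + e, m div p * h + m div q * k + m)"
proof -
  let ?O = "orbit (row_pair r s) (A, B)" and ?D = "down_closure (root_sum r s)"
  have recA: "A \<in> orbit (rowmotion r) A" and recB: "B \<in> orbit (rowmotion s) B"
    using rec AB by (auto simp: recurrent_def)
  note P = pair_recurrent[OF rec AB]
  have fin_O: "finite ?O"
    using P by (rule finite_orbit)
  have card_O: "card ?O = m"
    using r s orbit_map_prod(2)[OF recA recB] by (simp add: m_def orbit_data_def Let_def)
  have O_antichains: "finite A' \<and> finite B' \<and> A' \<in> antichains r \<and> B' \<in> antichains s"
    if "(A', B') \<in> ?O" for A' B'
  proof -
    have "A' \<in> antichains r" "B' \<in> antichains s"
      using that orbit_row_pair_subset[of r s "(A, B)"] by auto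
    then show ?thesis
      using fin by (auto simp: antichains_def intro: finite_subset)
  qed
  have inj: "inj_on fork ?O"
    using inj_fork by (rule inj_on_subset) simp
  have "(\<Sum>P\<in>?O. card (fork P)) = (\<Sum>(A', B')\<in>?O. card A' + card B')"
    by (rule sum.cong) (auto simp: card_fork dest!: O_antichains)
  also have "\<dots> = m div p * c + m div q * d"
    using r s sum_orbit_map_prod[OF recA recB, of card card]
    by (simp add: m_def orbit_data_def Let_def chi_def)
  finally have chi: "(\<Sum>P\<in>?O. card (fork P)) = m div p * c + m div q * d" .
  have "(\<Sum>P\<in>?O. card (?D (fork P))) =
      (\<Sum>P\<in>?O. (case P of (A', B') \<Rightarrow> card (down_closure r A') + card (down_closure s B'))
        + (if P = ({}, {}) then 0 else 1))"
    by (rule sum.cong) (auto simp: card_down_closure_fork fin dest!: O_antichains split: if_splits)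
  also have "\<dots> = m div p * h + m div q * k + (\<Sum>P\<in>?O. if P = ({}, {}) then 0 else 1)"
    using r s sum_orbit_map_prod[OF recA recB, of "\<lambda>A'. card (down_closure r A')" "\<lambda>B'. card (down_closure s B')"]
    by (simp add: sum.distrib m_def orbit_data_def Let_def chi_hat_def)
  finally have sum_hat: "(\<Sum>P\<in>?O. card (?D (fork P))) =
      m div p * h + m div q * k + (\<Sum>P\<in>?O. if P = ({}, {}) then 0 else 1)" .
  have chi_hat: "(\<Sum>P\<in>?O. card (?D (fork P))) + e = m div p * h + m div q * k + m"
  proof -
    have "(\<Sum>P\<in>?O. if P = ({}, {}) then 0 else 1) + e
        = (\<Sum>P\<in>?O. (if P = ({}, {}) then 0 else 1) + (if P = ({}, {}) then 1 else 0))"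
      using fin_O by (simp add: sum.distrib e_def sum.delta)
    also have "\<dots> = (\<Sum>P\<in>?O. 1)"
      by (intro sum.cong) auto
    finally have "(\<Sum>P\<in>?O. if P = ({}, {}) then 0 else 1) + e = m"
      using card_O by simp
    then show ?thesis
      by (simp add: sum_hat)
  qed
  show ?thesis
  proof (cases "({}, {}) \<in> ?O")
    case True
    have notin: "{None} \<notin> fork ` ?O"
      by (metis (no_types, lifting) fork_iffs(1) imageE insertI1)
    show ?thesis
      using True chi chi_hat card_O fin_O notin inj
      by (simp add: orbit_data_def orbit_fork_empty[OF P] chi_def chi_hat_def sum.reindex
          card_image down_closure_root e_def)
  next
    case False
    then show ?thesis
      using chi chi_hat card_O inj
      by (simp add: orbit_data_def orbit_fork_not_empty[OF P] chi_def chi_hat_def sum.reindex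
          card_image e_def)
  qed
qed

section \<open>Posets with one exceptional orbit\<close>

text \<open>
  This is the invariant of the induction over combs: all orbits have the same statistics, except
  for the orbit of the empty antichain.
\<close>
definition orbit_dichotomy :: "'a rel \<Rightarrow> nat \<times> nat \<times> nat \<Rightarrow> nat \<times> nat \<times> nat \<Rightarrow> bool" where
  "orbit_dichotomy r d e \<longleftrightarrow> finite (Field r) \<and> recurrent r \<and> orbit_data r {} = d \<and>
    (\<forall>A\<in>antichains r - orbit (rowmotion r) {}. orbit_data r A = e)"

lemma orbit_data_eq_of_mem:
  assumes "A \<in> orbit (rowmotion r) A" "B \<in> orbit (rowmotion r) A"
  shows "orbit_data r B = orbit_data r A"
  by (simp add: orbit_data_def orbit_eq_of_mem[OF assms])

lemma orbit_dichotomyD: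
  assumes "orbit_dichotomy r d e" "A \<in> antichains r"
  shows "orbit_data r A = (if A \<in> orbit (rowmotion r) {} then d else e)"
proof -
  have "{} \<in> orbit (rowmotion r) {}"
    using assms by (simp add: orbit_dichotomy_def recurrent_def)
  then show ?thesis
    using assms orbit_data_eq_of_mem[of "{}" r A] by (simp add: orbit_dichotomy_def)
qed

lemma card_antichains_root_sum:
  assumes "finite (Field r)" "finite (Field s)"
  shows "card (antichains (root_sum r s)) = card (antichains r) * card (antichains s) + 1"
proof -
  have "inj_on fork (antichains r \<times> antichains s)"
    using inj_fork by (rule inj_on_subset) simp
  moreover have "{None} \<notin> fork ` (antichains r \<times> antichains s)"
    by (metis (no_types, lifting) fork_iffs(1) imageE insertI1)
  ultimately show ?thesis
    using assms by (simp add: antichains_root_sum finite_antichains card_image card_cartesian_product)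
qed

lemma orbit_root_sum_empty:
  assumes "recurrent r" "recurrent s"
  shows "orbit (rowmotion (root_sum r s)) {} = insert {None} (fork ` orbit (row_pair r s) ({}, {}))"
  using orbit_fork_empty[of "({}, {})" r s] pair_recurrent[OF assms, of "{}" "{}"] by simp

lemma fork_in_orbit_empty_iff:
  assumes "recurrent r" "recurrent s" "A \<in> antichains r" "B \<in> antichains s"
  shows "fork (A, B) \<in> orbit (rowmotion (root_sum r s)) {} \<longleftrightarrow>
    ({}, {}) \<in> orbit (row_pair r s) (A, B)"
proof -
  have "fork (A, B) \<in> orbit (rowmotion (root_sum r s)) {} \<longleftrightarrow> (A, B) \<in> orbit (row_pair r s) ({}, {})"
    unfolding orbit_root_sum_empty[OF assms(1,2)]
    by (metis (no_types, lifting) fork_iffs(1) imageE imageI inj_fork injD insertE insertI1 insertI2)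
  also have "\<dots> \<longleftrightarrow> ({}, {}) \<in> orbit (row_pair r s) (A, B)"
    using pair_recurrent[OF assms(1,2)] assms(3,4) by (metis empty_in_antichains orbit_swap)
  finally show ?thesis .
qed

text \<open>
  If the two exceptional orbits have coprime sizes, their product is a single orbit, so it is the
  one that receives the root.
\<close>
lemma empty_in_pair_orbit_coprime:
  assumes "recurrent r" "recurrent s"
    and A: "A \<in> orbit (rowmotion r) {}" and B: "B \<in> orbit (rowmotion s) {}"
    and cop: "coprime (card (orbit (rowmotion r) {})) (card (orbit (rowmotion s) {}))"
  shows "({}, {}) \<in> orbit (row_pair r s) (A, B)"
proof -
  have e: "{} \<in> orbit (rowmotion r) {}" "{} \<in> orbit (rowmotion s) {}"
    using assms by (simp_all add: recurrent_def)
  have "orbit (row_pair r s) ({}, {}) = orbit (rowmotion r) {} \<times> orbit (rowmotion s) {}"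
    using e cop by (rule orbit_map_prod_coprime)
  then have "(A, B) \<in> orbit (row_pair r s) ({}, {})"
    using A B by simp
  moreover have "({}, {}) \<in> orbit (row_pair r s) ({}, {})"
    using assms(1,2) by (simp add: pair_recurrent)
  ultimately show ?thesis
    by (rule orbit_swap[rotated])
qed

lemma empty_in_pair_orbitD:
  assumes "recurrent r" "recurrent s" "A \<in> antichains r" "B \<in> antichains s"
    and "({}, {}) \<in> orbit (row_pair r s) (A, B)"
  shows "A \<in> orbit (rowmotion r) {}" "B \<in> orbit (rowmotion s) {}"
proof -
  have "(A, B) \<in> orbit (row_pair r s) ({}, {})"
    using pair_recurrent[OF assms(1-4)] assms(5) by (rule orbit_swap)
  moreover have "P \<in> orbit (rowmotion r) {} \<times> orbit (rowmotion s) {}"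
    if "P \<in> orbit (row_pair r s) ({}, {})" for P
    using that by induction (auto intro: orbit.intros)
  ultimately show "A \<in> orbit (rowmotion r) {}" "B \<in> orbit (rowmotion s) {}"
    by blast+
qed

definition point :: "unit rel" where
  "point = {((), ())}"

lemma Field_point: "Field point = {()}"
  by (simp add: point_def Field_def)

lemma antichains_point: "antichains point = {{}, {()}}"
  by (auto simp: antichains_def Field_point)

lemma rowmotion_point: "rowmotion point {} = {()}" "rowmotion point {()} = {}"
  by (auto simp: rowmotion_def minimals_def down_closure_def Field_point point_def)

lemma orbit_point:
  assumes "A \<in> antichains point"
  shows "orbit (rowmotion point) A = {{}, {()}}"
proof -
  have "B \<in> {{}, {()}}" if "B \<in> orbit (rowmotion point) A" for B
    using that orbit_rowmotion_subset[of point A] by (auto simp: antichains_point)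
  moreover have "{} \<in> orbit (rowmotion point) A" "{()} \<in> orbit (rowmotion point) A"
    using assms rowmotion_point orbit.base[of "rowmotion point" A] orbit.step[of _ "rowmotion point" A]
    unfolding antichains_point by (metis empty_iff insert_iff)+
  ultimately show ?thesis
    by blast
qed

lemma recurrent_point: "recurrent point"
  by (simp add: recurrent_def orbit_point) (simp add: antichains_point)

lemma orbit_data_point:
  assumes "A \<in> antichains point"
  shows "orbit_data point A = (2, 1, 1)"
proof -
  have "down_closure point {()} = {()}"
    by (auto simp: down_closure_def Field_point point_def)
  then show ?thesis
    by (simp add: orbit_data_def orbit_point[OF assms] chi_def chi_hat_def)
qed

text \<open>
  The smallest comb with a spine has to be treated apart: the two orbits of size 2 are not coprime
  and split into two product orbits, one of which receives the root.
\<close>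
lemma dichotomy_two_points: "orbit_dichotomy (root_sum point point) (3, 3, 4) (2, 2, 4)"
proof -
  have pair: "orbit_data (root_sum point point) (fork (A, B)) =
      (if ({}, {}) \<in> orbit (row_pair point point) (A, B) then (3, 3, 4) else (2, 2, 4))"
    if "A \<in> antichains point" "B \<in> antichains point" for A B
    using orbit_data_fork[OF _ _ recurrent_point recurrent_point that orbit_data_point orbit_data_point] that
    by (simp add: Field_point)
  have "orbit_data (root_sum point point) {} = (3, 3, 4)"
    using pair[of "{}" "{}"] pair_recurrent[OF recurrent_point recurrent_point, of "{}" "{}"] by simp
  moreover have "orbit_data (root_sum point point) C = (2, 2, 4)"
    if C: "C \<in> antichains (root_sum point point) - orbit (rowmotion (root_sum point point)) {}" for C
  proof -
    obtain A B where "C = fork (A, B)" "A \<in> antichains point" "B \<in> antichains point"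
      using C by (auto simp: antichains_root_sum orbit_root_sum_empty recurrent_point)
    then show ?thesis
      using C pair[of A B] by (simp add: fork_in_orbit_empty_iff recurrent_point)
  qed
  ultimately show ?thesis
    by (simp add: orbit_dichotomy_def recurrent_root_sum recurrent_point Field_root_sum Field_point)
qed

text \<open>
  The point visits its two antichains alternately.  Over one turn it contributes 1 to the antichain
  sizes for every two steps, and the same to the ideal sizes.
\<close>
lemma dichotomy_adjoin_point:
  assumes r: "orbit_dichotomy r (p, c, h) (2, d, k)" and "odd p"
  shows "orbit_dichotomy (root_sum r point) (2 * p + 1, 2 * c + p + 1, 2 * h + 3 * p) (2, d + 1, k + 3)"
proof -
  have rec: "recurrent r" and fin: "finite (Field r)"
    using r by (simp_all add: orbit_dichotomy_def)
  have size: "card (orbit (rowmotion r) {}) = p"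
    using r by (simp add: orbit_dichotomy_def orbit_data_def Let_def)
  have lcm: "lcm p 2 = 2 * p"
    using \<open>odd p\<close> by (simp add: lcm_coprime mult.commute)
  have p: "p > 0"
    using \<open>odd p\<close> by (rule odd_pos)
  have data: "orbit_data (root_sum r point) (fork (A, B)) =
      (if ({}, {}) \<in> orbit (row_pair r point) (A, B)
        then (2 * p + 1, 2 * c + p + 1, 2 * h + 3 * p) else (2, d + 1, k + 3))"
    if A: "A \<in> antichains r" and B: "B \<in> antichains point" for A B
  proof (cases "A \<in> orbit (rowmotion r) {}")
    case True
    have "({}, {}) \<in> orbit (row_pair r point) (A, B)"
    proof (rule empty_in_pair_orbit_coprime[OF rec recurrent_point True])
      show "B \<in> orbit (rowmotion point) {}"
        using B by (simp add: orbit_point) (simp add: antichains_point)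
      show "coprime (card (orbit (rowmotion r) {})) (card (orbit (rowmotion point) {}))"
        using \<open>odd p\<close> by (simp add: size orbit_point flip: numeral_2_eq_2)
    qed
    moreover have "orbit_data r A = (p, c, h)"
      using orbit_dichotomyD[OF r A] True by simp
    ultimately show ?thesis
      using orbit_data_fork[OF fin _ rec recurrent_point A B _ orbit_data_point[OF B]] p
      by (simp add: Field_point lcm)
  next
    case False
    then have "({}, {}) \<notin> orbit (row_pair r point) (A, B)"
      using empty_in_pair_orbitD(1)[OF rec recurrent_point A B] by blast
    moreover have "orbit_data r A = (2, d, k)"
      using orbit_dichotomyD[OF r A] False by simp
    ultimately show ?thesis
      using orbit_data_fork[OF fin _ rec recurrent_point A B _ orbit_data_point[OF B]]
      by (simp add: Field_point)
  qed
  have "orbit_data (root_sum r point) {} = (2 * p + 1, 2 * c + p + 1, 2 * h + 3 * p)"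
    using data[of "{}" "{}"] pair_recurrent[OF rec recurrent_point, of "{}" "{}"] by simp
  moreover have "orbit_data (root_sum r point) C = (2, d + 1, k + 3)"
    if C: "C \<in> antichains (root_sum r point) - orbit (rowmotion (root_sum r point)) {}" for C
  proof -
    obtain A B where "C = fork (A, B)" "A \<in> antichains r" "B \<in> antichains point"
      using C by (auto simp: antichains_root_sum orbit_root_sum_empty rec recurrent_point)
    then show ?thesis
      using C data[of A B] by (simp add: fork_in_orbit_empty_iff rec recurrent_point)
  qed
  ultimately show ?thesis
    using fin by (simp add: orbit_dichotomy_def recurrent_root_sum rec recurrent_point Field_root_sum Field_point)
qed

section \<open>Isomorphic posets\<close>

lemma Field_map_prod: "Field (map_prod f f ` r) = f ` Field r"
  by (force simp: Field_def)

lemma isomorphic_image_iff: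
  assumes "inj_on f (Field r)" "x \<in> Field r" "y \<in> Field r"
  shows "(f x, f y) \<in> map_prod f f ` r \<longleftrightarrow> (x, y) \<in> r"
proof
  assume "(f x, f y) \<in> map_prod f f ` r"
  then obtain a b where "(a, b) \<in> r" "f x = f a" "f y = f b"
    by auto
  then show "(x, y) \<in> r"
    using assms by (metis FieldI1 FieldI2 inj_onD)
qed force

lemma antichains_isomorphic_image:
  assumes f: "inj_on f (Field r)"
  shows "antichains (map_prod f f ` r) = (`) f ` antichains r"
proof (intro Set.equalityI subsetI)
  fix C
  assume C: "C \<in> antichains (map_prod f f ` r)"
  then have "C \<subseteq> f ` Field r"
    by (simp add: antichains_def Field_map_prod)
  then obtain A where A: "A \<subseteq> Field r" "C = f ` A"
    by (auto simp: subset_image_iff)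
  have "x = y" if "x \<in> A" "y \<in> A" "(x, y) \<in> r" for x y
  proof -
    have "f x = f y"
      using C that A by (force simp: antichains_def)
    then show ?thesis
      using f A that by (meson inj_onD subsetD)
  qed
  then show "C \<in> (`) f ` antichains r"
    using A by (auto simp: antichains_def)
next
  fix C
  assume "C \<in> (`) f ` antichains r"
  then obtain A where A: "A \<in> antichains r" "C = f ` A"
    by blast
  then have "A \<subseteq> Field r"
    by (simp add: antichains_def)
  then have "(f x, f y) \<in> map_prod f f ` r \<longleftrightarrow> (x, y) \<in> r" if "x \<in> A" "y \<in> A" for x y
    using that by (intro isomorphic_image_iff[OF f]) auto
  then show "C \<in> antichains (map_prod f f ` r)"
    using A \<open>A \<subseteq> Field r\<close> by (auto simp: antichains_def Field_map_prod simp del: map_prod_imageI)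
qed

lemma down_closure_isomorphic_image:
  assumes f: "inj_on f (Field r)" and A: "A \<subseteq> Field r"
  shows "down_closure (map_prod f f ` r) (f ` A) = f ` down_closure r A"
proof -
  define s where "s = map_prod f f ` r"
  have "(f x, f y) \<in> s \<longleftrightarrow> (x, y) \<in> r" if "x \<in> Field r" "y \<in> A" for x y
    unfolding s_def by (rule isomorphic_image_iff[OF f]) (use that A in auto)
  then have "{x \<in> f ` Field r. \<exists>y\<in>f ` A. (x, y) \<in> s} = f ` {x \<in> Field r. \<exists>y\<in>A. (x, y) \<in> r}"
    by blast
  then show ?thesis
    by (simp add: down_closure_def Field_map_prod s_def)
qed

lemma minimals_isomorphic_image:
  assumes f: "inj_on f (Field r)" and A: "A \<subseteq> Field r"
  shows "minimals (map_prod f f ` r) (f ` A) = f ` minimals r A"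
proof -
  define s where "s = map_prod f f ` r"
  have "(f x, f y) \<in> s \<longleftrightarrow> (x, y) \<in> r" if "x \<in> A" "y \<in> A" for x y
    unfolding s_def by (rule isomorphic_image_iff[OF f]) (use that A in auto)
  moreover have "f x = f y \<longleftrightarrow> x = y" if "x \<in> A" "y \<in> A" for x y
    using inj_on_eq_iff[OF f] that A by blast
  ultimately have "{x \<in> f ` A. \<forall>y\<in>f ` A. (y, x) \<in> s \<longrightarrow> y = x} = f ` {x \<in> A. \<forall>y\<in>A. (y, x) \<in> r \<longrightarrow> y = x}"
    by auto
  then show ?thesis
    by (simp add: minimals_def s_def)
qed

lemma rowmotion_isomorphic_image:
  assumes f: "inj_on f (Field r)" and A: "A \<subseteq> Field r"
  shows "rowmotion (map_prod f f ` r) (f ` A) = f ` rowmotion r A"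
proof -
  have "{x \<in> Field (map_prod f f ` r). x \<notin> down_closure (map_prod f f ` r) (f ` A)} =
      f ` Field r - f ` down_closure r A"
    by (auto simp: Field_map_prod down_closure_isomorphic_image[OF assms])
  also have "\<dots> = f ` (Field r - down_closure r A)"
    using f by (subst inj_on_image_set_diff[of f "Field r"]) (auto simp: down_closure_def)
  also have "Field r - down_closure r A = {x \<in> Field r. x \<notin> down_closure r A}"
    by blast
  finally show ?thesis
    unfolding rowmotion_def by (simp add: minimals_isomorphic_image[OF f])
qed

lemma orbit_isomorphic_image:
  assumes f: "inj_on f (Field r)" and A: "A \<in> orbit (rowmotion r) A"
  shows "orbit (rowmotion (map_prod f f ` r)) (f ` A) = (`) f ` orbit (rowmotion r) A"
proof (rule orbit_inverse[OF A, symmetric])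
  fix B
  assume "B \<in> orbit (rowmotion r) A"
  then have "B \<subseteq> Field r"
    using orbit_rowmotion_subset[of r A] by (auto simp: antichains_def)
  then show "rowmotion (map_prod f f ` r) (f ` B) = f ` rowmotion r B"
    by (rule rowmotion_isomorphic_image[OF f])
qed

lemma orbit_data_isomorphic_image:
  assumes f: "inj_on f (Field r)" and A: "A \<in> orbit (rowmotion r) A"
  shows "orbit_data (map_prod f f ` r) (f ` A) = orbit_data r A"
proof -
  have sub: "B \<subseteq> Field r" if "B \<in> orbit (rowmotion r) A" for B
    using that orbit_rowmotion_subset[of r A] by (auto simp: antichains_def)
  have inj: "inj_on ((`) f) (orbit (rowmotion r) A)"
    using inj_on_image_Pow[OF f] by (rule inj_on_subset) (use sub in auto)
  have "card (f ` B) = card B" if "B \<subseteq> Field r" for B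
    using f that by (meson card_image inj_on_subset)
  then have "card (f ` B) = card B"
    "card (down_closure (map_prod f f ` r) (f ` B)) = card (down_closure r B)"
    if "B \<in> orbit (rowmotion r) A" for B
    using sub[OF that] f by (simp_all add: down_closure_isomorphic_image) (auto simp: down_closure_def)
  then show ?thesis
    using inj by (simp add: orbit_data_def orbit_isomorphic_image[OF assms] chi_def chi_hat_def
        card_image sum.reindex Let_def)
qed

lemma orbit_dichotomy_isomorphic_image:
  assumes f: "inj_on f (Field r)" and r: "orbit_dichotomy r d e"
  shows "orbit_dichotomy (map_prod f f ` r) d e"
proof -
  let ?s = "map_prod f f ` r"
  have rec: "A \<in> orbit (rowmotion r) A" if "A \<in> antichains r" for A
    using r that by (simp add: orbit_dichotomy_def recurrent_def)
  have "recurrent ?s"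
    using rec by (auto simp: recurrent_def antichains_isomorphic_image[OF f] orbit_isomorphic_image[OF f])
  moreover have "orbit_data ?s {} = d"
    using orbit_data_isomorphic_image[OF f rec[of "{}"]] r by (simp add: orbit_dichotomy_def)
  moreover have "orbit_data ?s C = e" if C: "C \<in> antichains ?s - orbit (rowmotion ?s) {}" for C
  proof -
    obtain A where A: "A \<in> antichains r" "C = f ` A"
      using C by (auto simp: antichains_isomorphic_image[OF f])
    moreover have "A \<notin> orbit (rowmotion r) {}"
      using C A orbit_isomorphic_image[OF f rec[of "{}"]] by auto
    ultimately show ?thesis
      using r by (simp add: orbit_data_isomorphic_image[OF f] rec orbit_dichotomy_def)
  qed
  ultimately show ?thesis
    using r by (simp add: orbit_dichotomy_def Field_map_prod)
qed

lemma card_antichains_isomorphic_image: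
  assumes f: "inj_on f (Field r)"
  shows "card (antichains (map_prod f f ` r)) = card (antichains r)"
proof -
  have "inj_on ((`) f) (antichains r)"
    using inj_on_image_Pow[OF f] by (rule inj_on_subset) (auto simp: antichains_def)
  then show ?thesis
    by (simp add: antichains_isomorphic_image[OF f] card_image)
qed

section \<open>Combs\<close>

lemma comb_eq:
  "comb n = {(Spine i, Spine j) | i j. 2 \<le> j \<and> j \<le> i \<and> i \<le> n + 1} \<union>
    {(Spine i, Leaf j) | i j. 2 \<le> i \<and> 1 \<le> j \<and> j \<le> i \<and> i \<le> n + 1} \<union>
    {(Leaf i, Leaf i) | i. 1 \<le> i \<and> i \<le> n + 1}" (is "_ = ?R")
proof (intro Set.equalityI subrelI)
  fix x y
  assume "(x, y) \<in> comb n"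
  then have star: "(x, y) \<in> (comb_covers n)\<^sup>*" and verts: "x \<in> comb_verts n" "y \<in> comb_verts n"
    by (auto simp: comb_def)
  from star have "x = y \<or> (\<exists>i j. x = Spine i \<and> y = Spine j \<and> j \<le> i) \<or>
      (\<exists>i j. x = Spine i \<and> y = Leaf j \<and> j \<le> i)"
    by induction (auto simp: comb_covers_def)
  then show "(x, y) \<in> ?R"
    using verts by (auto simp: comb_verts_def)
next
  fix x y
  assume xy: "(x, y) \<in> ?R"
  have spine: "(Spine i, Spine j) \<in> (comb_covers n)\<^sup>*" if "j \<le> i" "2 \<le> j" "i \<le> n + 1" for i j
    using that
  proof (induction rule: dec_induct)
    case (step i)
    then have "(Spine (Suc i), Spine i) \<in> comb_covers n"
      by (force simp: comb_covers_def)
    then show ?case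
      using step by (simp add: converse_rtrancl_into_rtrancl)
  qed simp
  have leaf: "(Spine i, Leaf j) \<in> (comb_covers n)\<^sup>*" if "2 \<le> i" "1 \<le> j" "j \<le> i" "i \<le> n + 1" for i j
  proof -
    \<comment> \<open>Leaf 1 hangs on the same spine element as leaf 2.\<close>
    have "(Spine (max 2 j), Leaf j) \<in> comb_covers n"
      using that by (cases "j \<le> 2") (auto simp: comb_covers_def max_def le_Suc_eq numeral_2_eq_2)
    moreover have "(Spine i, Spine (max 2 j)) \<in> (comb_covers n)\<^sup>*"
      using that by (intro spine) auto
    ultimately show ?thesis
      by (rule rtrancl_into_rtrancl[rotated])
  qed
  show "(x, y) \<in> comb n"
    using xy spine leaf by (auto simp: comb_def comb_verts_def)
qed

definition comb_extension :: "nat \<Rightarrow> (comb_vertex + unit) option \<Rightarrow> comb_vertex" where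
  "comb_extension n = case_option (Spine (n + 2)) (case_sum id (\<lambda>_. Leaf (n + 2)))"

lemma inj_on_comb_extension: "inj_on (comb_extension n) (Field (root_sum (comb n) point))"
  by (auto simp: inj_on_def comb_extension_def Field_root_sum Field_comb comb_verts_def)

text \<open>
  The new root is the next spine element, the left branch is the old comb and the right branch is
  the new leaf.  For \<open>n = 0\<close> this reads \<^term>\<open>comb 0\<close> as the single leaf 1.
\<close>
lemma comb_Suc: "comb (Suc n) = map_prod (comb_extension n) (comb_extension n) ` root_sum (comb n) point"
proof -
  have "map_prod (comb_extension n) (comb_extension n) ` root_sum (comb n) point =
      Pair (Spine (n + 2)) ` ({Spine (n + 2), Leaf (n + 2)} \<union> comb_verts n) \<union> comb n \<union>
      {(Leaf (n + 2), Leaf (n + 2))}"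
  proof -
    have root_sum: "root_sum r s = Pair None ` insert None (Some ` (Field r <+> Field s)) \<union>
        map_prod (Some \<circ> Inl) (Some \<circ> Inl) ` r \<union> map_prod (Some \<circ> Inr) (Some \<circ> Inr) ` s"
      for r :: "comb_vertex rel" and s :: "unit rel"
      unfolding root_sum_def by (intro arg_cong2[where f = "(\<union>)"]) force+
    have "comb_extension n \<circ> (Some \<circ> Inl) = id"
      by (auto simp: comb_extension_def)
    then have "map_prod (comb_extension n) (comb_extension n) ` map_prod (Some \<circ> Inl) (Some \<circ> Inl) ` comb n = comb n"
      by (simp add: image_image prod.map_comp prod.map_id)
    moreover have "map_prod (comb_extension n) (comb_extension n) ` map_prod (Some \<circ> Inr) (Some \<circ> Inr) ` point =
        {(Leaf (n + 2), Leaf (n + 2))}"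
      by (simp add: point_def comb_extension_def)
    moreover have "map_prod (comb_extension n) (comb_extension n) `
          Pair None ` insert None (Some ` (Field (comb n) <+> Field point)) =
        Pair (Spine (n + 2)) ` ({Spine (n + 2), Leaf (n + 2)} \<union> comb_verts n)"
      by (simp add: Field_comb Field_point comb_extension_def Plus_def image_Un image_image)
    ultimately show ?thesis
      unfolding root_sum by (simp only: image_Un)
  qed
  also have "\<dots> = comb (Suc n)"
    unfolding comb_eq by (auto simp: comb_verts_def le_Suc_eq)
  finally show ?thesis ..
qed

lemma card_antichains_comb: "card (antichains (comb n)) = 3 * 2 ^ n - 1"
proof (induction n)
  case 0
  have comb_0: "comb 0 = {(Leaf 1, Leaf 1)}"
    by (auto simp: comb_eq)
  have "antichains (comb 0) = {{}, {Leaf 1}}"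
    by (auto simp: antichains_def comb_0 Field_def)
  then show ?case
    by simp
next
  case (Suc n)
  have "card (antichains (comb (Suc n))) = card (antichains (comb n)) * 2 + 1"
    by (simp add: comb_Suc card_antichains_isomorphic_image inj_on_comb_extension
        card_antichains_root_sum Field_comb Field_point comb_verts_def antichains_point)
  moreover have "(3::nat) * 2 ^ n \<ge> 3"
    by simp
  ultimately show ?case
    unfolding Suc.IH power_Suc by arith
qed

text \<open>
  The triples solve the recursions \<open>p' = 2 * p + 1\<close>, \<open>c' = 2 * c + p + 1\<close>, \<open>h' = 2 * h + 3 * p\<close> and
  \<open>d' = d + 1\<close>, \<open>k' = k + 3\<close> of \<open>dichotomy_adjoin_point\<close>, starting from \<open>dichotomy_two_points\<close>.
\<close>
lemma orbit_dichotomy_comb: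
  assumes "n \<ge> 1"
  shows "orbit_dichotomy (comb n)
    (2 ^ (n + 1) - 1, 2 ^ (n - 1) * (2 * n + 1), 2 ^ (n - 1) * (6 * n - 5) + 3)
    (2, n + 1, 3 * n + 1)"
  using assms
proof (induction n rule: nat_induct_at_least)
  case base
  let ?f = "case_option (Spine 2) (case_sum (\<lambda>_. Leaf 1) (\<lambda>_. Leaf 2))"
  have "comb 1 = {(Spine 2, Spine 2), (Spine 2, Leaf 1), (Spine 2, Leaf 2), (Leaf 1, Leaf 1), (Leaf 2, Leaf 2)}"
    unfolding comb_eq by auto
  moreover have "root_sum point point = {(None, None), (None, Some (Inl ())), (None, Some (Inr ())),
      (Some (Inl ()), Some (Inl ())), (Some (Inr ()), Some (Inr ()))}"
    by (auto simp: root_sum_def Field_point point_def)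
  ultimately have "comb 1 = map_prod ?f ?f ` root_sum point point"
    by simp
  moreover have "inj_on ?f (Field (root_sum point point))"
    by (auto simp: inj_on_def Field_root_sum Field_point)
  ultimately show ?case
    using orbit_dichotomy_isomorphic_image[OF _ dichotomy_two_points, of ?f] by (simp add: numeral_eq_Suc)
next
  case (Suc n)
  obtain m where n: "n = Suc m"
    using Suc.hyps by (cases n) auto
  \<comment> \<open>Writing the power as a successor makes the truncated subtractions exact.\<close>
  obtain y where y: "(2::nat) ^ m = Suc y"
    by (metis not0_implies_Suc power_not_zero zero_neq_numeral)
  have "odd (2 ^ (n + 1) - 1 :: nat)"
    by simp
  from dichotomy_adjoin_point[OF Suc.IH this]
  have "orbit_dichotomy (comb (Suc n))
    (2 * (2 ^ (n + 1) - 1) + 1, 2 * (2 ^ (n - 1) * (2 * n + 1)) + (2 ^ (n + 1) - 1) + 1,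
      2 * (2 ^ (n - 1) * (6 * n - 5) + 3) + 3 * (2 ^ (n + 1) - 1))
    (2, n + 1 + 1, 3 * n + 1 + 3)"
    unfolding comb_Suc by (rule orbit_dichotomy_isomorphic_image[OF inj_on_comb_extension])
  also have "2 * (2 ^ (n + 1) - 1) + 1 = (2 ^ (Suc n + 1) - 1 :: nat)"
    by (simp add: n y)
  also have "2 * (2 ^ (n - 1) * (2 * n + 1)) + (2 ^ (n + 1) - 1) + 1 = 2 ^ (Suc n - 1) * (2 * Suc n + 1)"
    by (simp add: n y algebra_simps)
  also have "2 * (2 ^ (n - 1) * (6 * n - 5) + 3) + 3 * (2 ^ (n + 1) - 1) = 2 ^ (Suc n - 1) * (6 * Suc n - 5) + 3"
    by (simp add: n y algebra_simps)
  finally show ?case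
    by simp
qed

section \<open>Zippers\<close>

text \<open>
  The antichains of the join of two copies, sorted by the kinds \<open>E\<close> (exceptional) and \<open>F\<close> (the
  others) of the two entries.  Only pairs of two exceptional entries can share an orbit with the
  root.
\<close>
lemma symmetric_root_sum:
  assumes r: "orbit_dichotomy r (p, c, h) (2, d, k)" and "odd p"
  defines "E \<equiv> orbit (rowmotion r) {}"
  defines "F \<equiv> antichains r - E"
  defines "Z \<equiv> root_sum r r"
  shows "C \<in> fork ` (F \<times> F) \<Longrightarrow> orbit_data Z C = (2, 2 * d, 2 * k + 2)"
    and "C \<in> fork ` (E \<times> E) - orbit (rowmotion Z) {} \<Longrightarrow> orbit_data Z C = (p, 2 * c, 2 * h + p)"
    and "C \<in> orbit (rowmotion Z) {} \<Longrightarrow> orbit_data Z C = (p + 1, 2 * c + 1, 2 * h + p)"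
    and "C \<in> fork ` (E \<times> F \<union> F \<times> E) \<Longrightarrow> orbit_data Z C = (2 * p, 2 * c + p * d, 2 * h + p * k + 2 * p)"
    and "antichains Z = fork ` (F \<times> F) \<union> (fork ` (E \<times> E) - orbit (rowmotion Z) {}) \<union>
      orbit (rowmotion Z) {} \<union> fork ` (E \<times> F \<union> F \<times> E)"
    and "orbit (rowmotion Z) {} \<subseteq> insert {None} (fork ` (E \<times> E))" "{None} \<in> orbit (rowmotion Z) {}"
proof -
  have rec: "recurrent r" and fin: "finite (Field r)"
    using r by (simp_all add: orbit_dichotomy_def)
  have E: "orbit_data r A = (p, c, h)" "A \<in> antichains r" if "A \<in> E" for A
    using that orbit_dichotomyD[OF r] orbit_rowmotion_subset[of r "{}"] by (auto simp: E_def)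
  have F: "orbit_data r A = (2, d, k)" "A \<in> antichains r" "A \<notin> E" if "A \<in> F" for A
    using that orbit_dichotomyD[OF r] by (auto simp: E_def F_def)
  have p: "p > 0"
    using \<open>odd p\<close> by (rule odd_pos)
  have lcm: "lcm p 2 = 2 * p" "lcm 2 p = 2 * p"
    using \<open>odd p\<close> by (simp_all add: lcm_coprime mult.commute lcm.commute[of 2])
  note data = orbit_data_fork[OF fin fin rec rec, folded Z_def]
  have empty_pair: "A \<in> E \<and> B \<in> E" if "({}, {}) \<in> orbit (row_pair r r) (A, B)"
    "A \<in> antichains r" "B \<in> antichains r" for A B
    using empty_in_pair_orbitD[OF rec rec that(2,3,1)] by (simp add: E_def)
  show "orbit_data Z C = (2, 2 * d, 2 * k + 2)" if mem: "C \<in> fork ` (F \<times> F)"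
  proof -
    obtain A B where C: "C = fork (A, B)" "A \<in> F" "B \<in> F"
      using mem by blast
    then have "({}, {}) \<notin> orbit (row_pair r r) (A, B)"
      using empty_pair F by blast
    then show ?thesis
      using data[of A B] C F by simp
  qed
  show "orbit_data Z C = (p, 2 * c, 2 * h + p)" if mem: "C \<in> fork ` (E \<times> E) - orbit (rowmotion Z) {}"
  proof -
    obtain A B where C: "C = fork (A, B)" "A \<in> E" "B \<in> E"
      using mem by blast
    then have "({}, {}) \<notin> orbit (row_pair r r) (A, B)"
      using mem E fork_in_orbit_empty_iff[OF rec rec, of A B] by (simp add: Z_def)
    then show ?thesis
      using data[of A B] C E p by simp
  qed
  have e: "{} \<in> E"
    using rec by (simp add: E_def recurrent_def)
  have recZ: "{} \<in> orbit (rowmotion Z) {}"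
    using recurrent_root_sum[OF rec rec] by (simp add: recurrent_def Z_def)
  have "orbit_data Z {} = (p + 1, 2 * c + 1, 2 * h + p)"
    using data[of "{}" "{}"] E[OF e] p pair_recurrent[OF rec rec, of "{}" "{}"] by simp
  then show "orbit_data Z C = (p + 1, 2 * c + 1, 2 * h + p)" if "C \<in> orbit (rowmotion Z) {}"
    using orbit_data_eq_of_mem[OF recZ that] by simp
  show "orbit_data Z C = (2 * p, 2 * c + p * d, 2 * h + p * k + 2 * p)"
    if mem: "C \<in> fork ` (E \<times> F \<union> F \<times> E)"
  proof -
    obtain A B where C: "C = fork (A, B)" "A \<in> E \<and> B \<in> F \<or> A \<in> F \<and> B \<in> E"
      using mem by blast
    then have "({}, {}) \<notin> orbit (row_pair r r) (A, B)"
      using empty_pair E F by blast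
    then show ?thesis
      using data[of A B] C E[of A] E[of B] F[of A] F[of B] p by (auto simp: lcm)
  qed
  have orbit: "orbit (rowmotion Z) {} = insert {None} (fork ` orbit (row_pair r r) ({}, {}))"
    unfolding Z_def by (rule orbit_root_sum_empty[OF rec rec])
  then show root: "{None} \<in> orbit (rowmotion Z) {}"
    by simp
  have EE: "P \<in> E \<times> E" if "P \<in> orbit (row_pair r r) ({}, {})" for P
    using that by induction (auto simp: E_def intro: orbit.intros)
  then show sub: "orbit (rowmotion Z) {} \<subseteq> insert {None} (fork ` (E \<times> E))"
    unfolding orbit by blast
  have split: "antichains r = E \<union> F"
    using orbit_rowmotion_subset[of r "{}"] by (auto simp: E_def F_def)
  have regroup: "insert z (X \<union> Y \<union> V) = X \<union> (Y - W) \<union> W \<union> V" if "z \<in> W" "W \<subseteq> insert z Y"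
    for z :: "('a + 'a) option set" and V W X Y
    using that by blast
  have "antichains Z = insert {None} (fork ` (F \<times> F \<union> E \<times> E \<union> (E \<times> F \<union> F \<times> E)))"
    unfolding Z_def antichains_root_sum split by (rule arg_cong[of _ _ "\<lambda>S. insert {None} (fork ` S)"]) blast
  with regroup[OF root sub] show "antichains Z = fork ` (F \<times> F) \<union> (fork ` (E \<times> E) - orbit (rowmotion Z) {}) \<union>
      orbit (rowmotion Z) {} \<union> fork ` (E \<times> F \<union> F \<times> E)"
    by (simp only: image_Un)
qed

text \<open>
  The statistics are constant along an orbit, so the antichains with given statistics form a union
  of orbits.
\<close>
lemma card_orbits_with_data:
  assumes "finite (Field r)" "recurrent r" and X: "X = {C \<in> antichains r. orbit_data r C = (l, c, h)}"
  shows "l * card (orbit (rowmotion r) ` X) = card X"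
proof (rule card_mult_orbits)
  show "finite X"
    using assms by (simp add: finite_antichains)
  show rec: "C \<in> orbit (rowmotion r) C" if "C \<in> X" for C
    using that assms by (simp add: recurrent_def)
  show "orbit (rowmotion r) C \<subseteq> X" if "C \<in> X" for C
  proof
    fix D
    assume D: "D \<in> orbit (rowmotion r) C"
    then have "orbit_data r D = orbit_data r C"
      by (rule orbit_data_eq_of_mem[OF rec[OF that]])
    then show "D \<in> X"
      using that D orbit_rowmotion_subset[of r C] by (simp add: X subsetD)
  qed
  show "card (orbit (rowmotion r) C) = l" if "C \<in> X" for C
    using that by (simp add: X orbit_data_def Let_def)
qed

text \<open>
  The number of orbits of each kind follows by counting antichains: \<open>E\<close> has \<open>p\<close> elements and \<open>F\<close> has
  \<open>t\<close>.  The hypothesis \<open>p \<ge> 3\<close> makes the four orbit sizes 2, \<open>p\<close>, \<open>p + 1\<close>, \<open>2 * p\<close> distinct, so that the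
  statistics tell the four kinds apart.
\<close>
lemma symmetric_root_sum_partition:
  assumes r: "orbit_dichotomy r (p, c, h) (2, d, k)" and "odd p" "p \<ge> 3"
  defines "Z \<equiv> root_sum r r" and "t \<equiv> card (antichains r) - p"
  obtains S M L G where "row_orbits Z = S \<union> M \<union> L \<union> G"
    and "2 * card S = t\<^sup>2" "\<forall>Orb\<in>S. (card Orb, chi Orb, chi_hat Z Orb) = (2, 2 * d, 2 * k + 2)"
    and "card M = p - 1" "\<forall>Orb\<in>M. (card Orb, chi Orb, chi_hat Z Orb) = (p, 2 * c, 2 * h + p)"
    and "card L = 1" "\<forall>Orb\<in>L. (card Orb, chi Orb, chi_hat Z Orb) = (p + 1, 2 * c + 1, 2 * h + p)"
    and "card G = t" "\<forall>Orb\<in>G. (card Orb, chi Orb, chi_hat Z Orb) =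
      (2 * p, 2 * c + p * d, 2 * h + p * k + 2 * p)"
proof -
  define E where "E = orbit (rowmotion r) {}"
  define F where "F = antichains r - E"
  define O0 where "O0 = orbit (rowmotion Z) {}"
  define XS where "XS = fork ` (F \<times> F)"
  define XM where "XM = fork ` (E \<times> E) - O0"
  define XG where "XG = fork ` (E \<times> F \<union> F \<times> E)"
  have rec: "recurrent r" and fin: "finite (Field r)"
    using r by (simp_all add: orbit_dichotomy_def)
  have finZ: "finite (Field Z)" and recZ: "recurrent Z"
    using fin rec by (simp_all add: Z_def Field_root_sum recurrent_root_sum)
  note sym = symmetric_root_sum[OF r \<open>odd p\<close>, folded E_def, folded F_def Z_def, folded O0_def, folded XS_def XM_def XG_def]
  have XS: "XS = {C \<in> antichains Z. orbit_data Z C = (2, 2 * d, 2 * k + 2)}"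
    and XM: "XM = {C \<in> antichains Z. orbit_data Z C = (p, 2 * c, 2 * h + p)}"
    and XL: "O0 = {C \<in> antichains Z. orbit_data Z C = (p + 1, 2 * c + 1, 2 * h + p)}"
    and XG: "XG = {C \<in> antichains Z. orbit_data Z C = (2 * p, 2 * c + p * d, 2 * h + p * k + 2 * p)}"
    using sym(1-4) \<open>p \<ge> 3\<close> unfolding sym(5) by auto
  have card_E: "card E = p"
    using r by (simp add: orbit_dichotomy_def orbit_data_def Let_def E_def)
  have "E \<subseteq> antichains r"
    unfolding E_def by (rule orbit_rowmotion_subset)
  then have finE: "finite E" and finF: "finite F" and card_F: "card F = t"
    using finite_antichains[OF fin] card_E by (simp_all add: F_def t_def card_Diff_subset finite_subset)
  have card_fork_image: "card (fork ` Q) = card Q" for Q :: "('a set \<times> 'a set) set"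
    by (intro card_image inj_on_subset[OF inj_fork] subset_UNIV)
  have card_O0: "card O0 = p + 1"
  proof -
    have "{} \<in> O0"
      using recZ by (simp add: O0_def recurrent_def)
    then show ?thesis
      using sym(3)[of "{}"] by (simp add: orbit_data_def Let_def flip: O0_def)
  qed
  have "card XS = t\<^sup>2"
    by (simp add: XS_def card_fork_image card_cartesian_product card_F power2_eq_square)
  moreover have "card XM = p * p - p"
  proof -
    \<comment> \<open>Of the \<open>p + 1\<close> members of the exceptional orbit, only the root is not a fork.\<close>
    have "{None} \<notin> fork ` (E \<times> E)"
      by (metis (no_types, lifting) fork_iffs(1) imageE insertI1)
    then have "XM = fork ` (E \<times> E) - (O0 - {{None}})"
      unfolding XM_def by blast
    moreover have "O0 - {{None}} \<subseteq> fork ` (E \<times> E)"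
      using sym(6) by blast
    moreover have "card (O0 - {{None}}) = p"
      using sym(7) card_O0 by simp
    moreover have "finite O0"
      using card_O0 by (metis card.infinite add_is_0 one_neq_zero)
    ultimately show ?thesis
      by (simp add: card_Diff_subset card_fork_image card_cartesian_product card_E)
  qed
  moreover have "card XG = 2 * p * t"
  proof -
    have "E \<times> F \<inter> F \<times> E = {}"
      by (auto simp: F_def)
    then show ?thesis
      using finE finF by (simp add: XG_def card_fork_image card_Un_disjoint card_cartesian_product card_E card_F)
  qed
  ultimately have counts: "2 * card (orbit (rowmotion Z) ` XS) = t\<^sup>2"
    "p * card (orbit (rowmotion Z) ` XM) = p * (p - 1)" "2 * p * card (orbit (rowmotion Z) ` XG) = 2 * p * t"
    using card_orbits_with_data[OF finZ recZ XS] card_orbits_with_data[OF finZ recZ XM]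
      card_orbits_with_data[OF finZ recZ XG] by (simp_all add: right_diff_distrib')
  have single: "(p + 1) * card (orbit (rowmotion Z) ` O0) = p + 1"
    using card_orbits_with_data[OF finZ recZ XL] card_O0 by simp
  show ?thesis
  proof (rule that)
    show "row_orbits Z = orbit (rowmotion Z) ` XS \<union> orbit (rowmotion Z) ` XM \<union>
        orbit (rowmotion Z) ` O0 \<union> orbit (rowmotion Z) ` XG"
      unfolding row_orbits_def sym(5) by (simp only: image_Un)
    show "2 * card (orbit (rowmotion Z) ` XS) = t\<^sup>2"
      by (rule counts)
    show "card (orbit (rowmotion Z) ` XM) = p - 1" "card (orbit (rowmotion Z) ` XG) = t"
      using counts(2,3) \<open>p \<ge> 3\<close> by simp_all
    show "card (orbit (rowmotion Z) ` O0) = 1"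
      using single by (metis add_is_0 mult_cancel1 nat_mult_1_right one_neq_zero)
  qed (use sym(1-4) in \<open>simp_all add: orbit_data_def Let_def\<close>)
qed

theorem theorem5p3:
  fixes n :: nat
  assumes "n \<ge> 1"
  shows "(\<exists>S M L G.
      row_orbits (zipper n) = S \<union> M \<union> L \<union> G \<and>
      S \<inter> M = {} \<and> S \<inter> L = {} \<and> S \<inter> G = {} \<and>
      M \<inter> L = {} \<and> M \<inter> G = {} \<and> L \<inter> G = {} \<and>
      card S = 2 ^ (2 * n - 1) \<and>
      (\<forall>Orb\<in>S. card Orb = 2 \<and>
                chi Orb = 2 * n + 2 \<and>
                chi_hat (zipper n) Orb = 6 * n + 4) \<and>
      card M = 2 ^ (n + 1) - 2 \<and>
      (\<forall>Orb\<in>M. card Orb = 2 ^ (n + 1) - 1 \<and>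
                chi Orb = 2 ^ n * (2 * n + 1) \<and>
                chi_hat (zipper n) Orb = 3 * 2 ^ n * (2 * n - 1) + 5) \<and>
      card L = 1 \<and>
      (\<forall>Orb\<in>L. card Orb = 2 ^ (n + 1) \<and>
                chi Orb = 2 ^ n * (2 * n + 1) + 1 \<and>
                chi_hat (zipper n) Orb = 3 * 2 ^ n * (2 * n - 1) + 5) \<and>
      card G = 2 ^ n \<and>
      (\<forall>Orb\<in>G. card Orb = 2 ^ (n + 2) - 2 \<and>
                chi Orb = 2 ^ n * (4 * n + 3) - n - 1 \<and>
                chi_hat (zipper n) Orb = 2 ^ n * (12 * n + 1) - 3 * n + 3))
    \<and> homometric (zipper n) chi
    \<and> homometric (zipper n) (chi_hat (zipper n))"
proof -
  define p where "p = (2::nat) ^ (n + 1) - 1"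
  define c where "c = (2::nat) ^ (n - 1) * (2 * n + 1)"
  define h where "h = (2::nat) ^ (n - 1) * (6 * n - 5) + 3"
  define d where "d = n + 1"
  define k where "k = 3 * n + 1"
  obtain m where n: "n = Suc m"
    using assms by (cases n) auto
  \<comment> \<open>Writing the power as a successor makes the truncated subtractions exact.\<close>
  obtain y where y: "(2::nat) ^ m = Suc y"
    by (metis not0_implies_Suc power_not_zero zero_neq_numeral)
  have p: "p = 4 * y + 3"
    by (simp add: p_def n y)
  have comb: "orbit_dichotomy (comb n) (p, c, h) (2, d, k)"
    unfolding p_def c_def h_def d_def k_def using assms by (rule orbit_dichotomy_comb)
  have t: "card (antichains (comb n)) - p = 2 ^ n"
    by (simp add: card_antichains_comb p n y)
  obtain S M L G where orbits: "row_orbits (zipper n) = S \<union> M \<union> L \<union> G"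
    and S: "2 * card S = (2 ^ n)\<^sup>2" "\<forall>Orb\<in>S. (card Orb, chi Orb, chi_hat (zipper n) Orb) = (2, 2 * d, 2 * k + 2)"
    and M: "card M = p - 1" "\<forall>Orb\<in>M. (card Orb, chi Orb, chi_hat (zipper n) Orb) = (p, 2 * c, 2 * h + p)"
    and L: "card L = 1" "\<forall>Orb\<in>L. (card Orb, chi Orb, chi_hat (zipper n) Orb) = (p + 1, 2 * c + 1, 2 * h + p)"
    and G: "card G = 2 ^ n" "\<forall>Orb\<in>G. (card Orb, chi Orb, chi_hat (zipper n) Orb) =
      (2 * p, 2 * c + p * d, 2 * h + p * k + 2 * p)"
  proof (rule symmetric_root_sum_partition[OF comb, folded zipper_def, unfolded t])
    show "odd p" "3 \<le> p"
      by (simp_all add: p)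
  qed
  have sizes: "distinct [2, p, p + 1, 2 * p]"
    by (simp add: p)
  have homometric: "chi Orb1 = chi Orb2 \<and> chi_hat (zipper n) Orb1 = chi_hat (zipper n) Orb2"
    if "Orb1 \<in> row_orbits (zipper n)" "Orb2 \<in> row_orbits (zipper n)" "card Orb1 = card Orb2" for Orb1 Orb2
    using that S(2) M(2) L(2) G(2) sizes unfolding orbits by auto
  have "S \<inter> M = {}" "S \<inter> L = {}" "S \<inter> G = {}" "M \<inter> L = {}" "M \<inter> G = {}" "L \<inter> G = {}"
    using S(2) M(2) L(2) G(2) sizes by fastforce+
  moreover have "card S = 2 ^ (2 * n - 1)"
  proof -
    have "(2 ^ n)\<^sup>2 = 2 * (2::nat) ^ (2 * n - 1)"
      by (simp add: n power_even_eq power2_eq_square)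
    then show ?thesis
      using S(1) by simp
  qed
  moreover have "2 * d = 2 * n + 2" "2 * k + 2 = 6 * n + 4"
    by (simp_all add: d_def k_def)
  moreover have "p = 2 ^ (n + 1) - 1" "p - 1 = 2 ^ (n + 1) - 2" "p + 1 = 2 ^ (n + 1)" "2 * p = 2 ^ (n + 2) - 2"
    by (simp_all add: p n y)
  moreover have "2 * c = 2 ^ n * (2 * n + 1)"
    by (simp add: c_def n)
  moreover have "2 * h + p = 3 * 2 ^ n * (2 * n - 1) + 5"
    by (simp add: h_def n p y algebra_simps)
  moreover have "2 * c + p * d = 2 ^ n * (4 * n + 3) - n - 1"
    by (simp add: c_def d_def n p y algebra_simps)
  moreover have "2 * h + p * k + 2 * p = 2 ^ n * (12 * n + 1) - 3 * n + 3"
    by (simp add: h_def k_def n p y algebra_simps)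
  ultimately have "row_orbits (zipper n) = S \<union> M \<union> L \<union> G \<and>
      S \<inter> M = {} \<and> S \<inter> L = {} \<and> S \<inter> G = {} \<and>
      M \<inter> L = {} \<and> M \<inter> G = {} \<and> L \<inter> G = {} \<and>
      card S = 2 ^ (2 * n - 1) \<and>
      (\<forall>Orb\<in>S. card Orb = 2 \<and>
                chi Orb = 2 * n + 2 \<and>
                chi_hat (zipper n) Orb = 6 * n + 4) \<and>
      card M = 2 ^ (n + 1) - 2 \<and>
      (\<forall>Orb\<in>M. card Orb = 2 ^ (n + 1) - 1 \<and>
                chi Orb = 2 ^ n * (2 * n + 1) \<and>
                chi_hat (zipper n) Orb = 3 * 2 ^ n * (2 * n - 1) + 5) \<and>
      card L = 1 \<and>
      (\<forall>Orb\<in>L. card Orb = 2 ^ (n + 1) \<and>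
                chi Orb = 2 ^ n * (2 * n + 1) + 1 \<and>
                chi_hat (zipper n) Orb = 3 * 2 ^ n * (2 * n - 1) + 5) \<and>
      card G = 2 ^ n \<and>
      (\<forall>Orb\<in>G. card Orb = 2 ^ (n + 2) - 2 \<and>
                chi Orb = 2 ^ n * (4 * n + 3) - n - 1 \<and>
                chi_hat (zipper n) Orb = 2 ^ n * (12 * n + 1) - 3 * n + 3)"
    using orbits S(2) M L G by (simp only: prod.inject simp_thms)
  then show ?thesis
    using homometric unfolding homometric_def by blast
qed

end
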